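(* For every $n\ge0$, $$|\mathcal{RS}_n(132,213)|=F_{n+1},$$ where $F_m$ denotes the $m$-th Fibonacci number.
   Context: $\mathfrak{S}_n$ is the set of permutations of $\{1,\dots,n\}$, written in one-line notation $\pi=\pi_1\pi_2\dots\pi_n$ ($\mathfrak{S}_0$ consists of the empty permutation). A permutation $\pi\in\mathfrak{S}_n$ is simsun if for every $3\le k\le n$, the subword of $\pi_1\pi_2\dots\pi_n$ consisting of the entries in $\{1,\dots,k\}$ (kept in their order) has no double descent, i.e. no three entries that are consecutive in that subword and in decreasing order. A permutation $\pi\in\mathfrak{S}_n$ avoids the pattern $\sigma\in\mathfrak{S}_k$ if there are no indices $i_1<i_2<\dots<i_k$ such that $\pi_{i_1}\pi_{i_2}\dots\pi_{i_k}$ is in the same relative order as $\sigma$. $\mathcal{RS}_n(\sigma,\tau)$ is the set of simsun permutations in $\mathfrak{S}_n$ avoiding both $\sigma$ and $\tau$. The Fibonacci numbers are given by $\sum_{n\ge0}F_nz^n=\frac{z}{1-z-z^2}$, i.e. $F_0=0$, $F_1=1$, $F_{n+2}=F_{n+1}+F_n$. *)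

theory Defs
  imports "HOL-Combinatorics.Multiset_Permutations" "HOL-Number_Theory.Fib"
begin

text \<open>
  A permutation of {1,...,n} is represented by its one-line notation, i.e. by a list in
  \<^term>\<open>permutations_of_set {1..n}\<close>. List positions are counted from 0.
\<close>

definition has_double_descent :: "nat list \<Rightarrow> bool" where
  "has_double_descent w \<longleftrightarrow>
     (\<exists>i. i + 2 < length w \<and> w ! i > w ! (i + 1) \<and> w ! (i + 1) > w ! (i + 2))"

definition simsun :: "nat \<Rightarrow> nat list \<Rightarrow> bool" where
  "simsun n p \<longleftrightarrow> p \<in> permutations_of_set {1..n} \<and>
     (\<forall>k. 3 \<le> k \<and> k \<le> n \<longrightarrow> \<not> has_double_descent (filter (\<lambda>x. x \<in> {1..k}) p))"

text \<open>The function \<open>f\<close> lists the positions of an occurrence of \<open>s\<close> in \<open>p\<close>.\<close>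

definition contains_pattern :: "nat list \<Rightarrow> nat list \<Rightarrow> bool" where
  "contains_pattern p s \<longleftrightarrow>
     (\<exists>f :: nat \<Rightarrow> nat. strict_mono_on {..<length s} f \<and> f ` {..<length s} \<subseteq> {..<length p} \<and>
        (\<forall>i<length s. \<forall>j<length s. p ! f i < p ! f j \<longleftrightarrow> s ! i < s ! j))"

abbreviation avoids_pattern :: "nat list \<Rightarrow> nat list \<Rightarrow> bool" where
  "avoids_pattern p s \<equiv> \<not> contains_pattern p s"

definition RS :: "nat \<Rightarrow> nat list \<Rightarrow> nat list \<Rightarrow> nat list set" where
  "RS n s t = {p. simsun n p \<and> avoids_pattern p s \<and> avoids_pattern p t}"

end

theory Submission
  imports Defs
begin

text \<open>
  Let \<open>N\<close> be the largest entry of a permutation avoiding 132 and 213. If \<open>N\<close> is not the first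
  entry, then the entry \<open>x\<close> just before it must be \<open>N - 1\<close>: otherwise \<open>N - 1\<close> would stand
  before \<open>x\<close>, giving the pattern 213 with \<open>x\<close> and \<open>N\<close>, or after \<open>N\<close>, giving the pattern 132
  with \<open>x\<close> and \<open>N\<close>. Conversely, inserting \<open>N\<close> directly after \<open>N - 1\<close> creates neither a
  forbidden pattern nor a double descent. So deleting \<open>N\<close> is a bijection from the simsun
  avoiders of length \<open>N\<close> that do not begin with \<open>N\<close> onto all simsun avoiders of length \<open>N - 1\<close>
  (\<open>card_RS_132_213_max_not_first\<close>).

  If \<open>N\<close> is the first entry, it takes part in no forbidden pattern, so the only constraint
  it adds is that no descent follows it. The rest \<open>q\<close> has no initial descent precisely when \<open>q\<close>
  does not begin with its own largest entry \<open>N - 1\<close>: a descent \<open>y > z\<close> with \<open>y < N - 1\<close> at the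
  beginning would form 213 with \<open>N - 1\<close> (\<open>RS_132_213_Cons_max_iff\<close>; the exception is a rest of
  length 1). By the first case, these \<open>q\<close> are as many as the simsun avoiders of length \<open>N - 2\<close>.

  Together this is the Fibonacci recurrence, with one permutation each for lengths 0 and 1.
\<close>

section \<open>Patterns of length three in terms of relative position\<close>

text \<open>
  For a list without repetitions, occurrences of a pattern of length three are described by
  values alone: \<open>a, b, c\<close> occur in this order iff \<open>a\<close> is before \<open>b\<close> and \<open>b\<close> before \<open>c\<close>. Unlike
  positions, this relation is stable under deletion and insertion of other entries.
\<close>

primrec before :: "'a list \<Rightarrow> 'a \<Rightarrow> 'a \<Rightarrow> bool" where
  "before [] x y \<longleftrightarrow> False"
| "before (z # zs) x y \<longleftrightarrow> (x = z \<and> y \<in> set zs) \<or> before zs x y"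

lemma before_append:
  "before (us @ vs) x y \<longleftrightarrow> before us x y \<or> before vs x y \<or> (x \<in> set us \<and> y \<in> set vs)"
  by (induction us) auto

lemma before_in_set: "before p x y \<Longrightarrow> x \<in> set p \<and> y \<in> set p"
  by (induction p) auto

lemma before_iff_nth:
  "before p x y \<longleftrightarrow> (\<exists>i j. i < j \<and> j < length p \<and> p ! i = x \<and> p ! j = y)"
proof (induction p)
  case (Cons z zs)
  show ?case
  proof
    assume "before (z # zs) x y"
    then consider "x = z" "y \<in> set zs" | "before zs x y" by auto
    then show "\<exists>i j. i < j \<and> j < length (z # zs) \<and> (z # zs) ! i = x \<and> (z # zs) ! j = y"
    proof cases
      case 1
      then obtain j where "j < length zs" "zs ! j = y" by (auto simp: in_set_conv_nth)
      with 1 show ?thesis by (intro exI[of _ 0] exI[of _ "Suc j"]) auto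
    next
      case 2
      with Cons obtain i j where "i < j" "j < length zs" "zs ! i = x" "zs ! j = y" by auto
      then show ?thesis by (intro exI[of _ "Suc i"] exI[of _ "Suc j"]) auto
    qed
  next
    assume "\<exists>i j. i < j \<and> j < length (z # zs) \<and> (z # zs) ! i = x \<and> (z # zs) ! j = y"
    then obtain i j where ij: "i < j" "j < length (z # zs)" "(z # zs) ! i = x" "(z # zs) ! j = y"
      by auto
    then obtain j' where j': "j = Suc j'" by (cases j) auto
    show "before (z # zs) x y"
    proof (cases i)
      case 0
      with ij j' show ?thesis by auto
    next
      case (Suc i')
      with ij j' have "i' < j' \<and> j' < length zs \<and> zs ! i' = x \<and> zs ! j' = y" by auto
      then have "before zs x y" using Cons by blast
      then show ?thesis by simp
    qed
  qed
qed simp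

lemma contains_pattern_length_3:
  "contains_pattern p [s, t, u] \<longleftrightarrow>
     (\<exists>i j k. i < j \<and> j < k \<and> k < length p \<and>
        (p ! i < p ! j \<longleftrightarrow> s < t) \<and> (p ! j < p ! i \<longleftrightarrow> t < s) \<and>
        (p ! i < p ! k \<longleftrightarrow> s < u) \<and> (p ! k < p ! i \<longleftrightarrow> u < s) \<and>
        (p ! j < p ! k \<longleftrightarrow> t < u) \<and> (p ! k < p ! j \<longleftrightarrow> u < t))"
    (is "_ \<longleftrightarrow> (\<exists>i j k. ?occ i j k)")
proof -
  have len: "length [s, t, u] = 3" by simp
  show ?thesis
  proof
    assume "contains_pattern p [s, t, u]"
    then obtain f where f: "strict_mono_on {..<3::nat} f" "f ` {..<3} \<subseteq> {..<length p}"
      "\<forall>i<3. \<forall>j<3. p ! f i < p ! f j \<longleftrightarrow> [s, t, u] ! i < [s, t, u] ! j"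
      unfolding contains_pattern_def len by blast
    have "f 0 < f 1" "f 1 < f 2"
      using f(1) by (auto simp: strict_mono_on_def)
    moreover have "f 2 < length p"
      using f(2) by (auto simp: image_subset_iff)
    moreover have "p ! f i < p ! f j \<longleftrightarrow> [s, t, u] ! i < [s, t, u] ! j" if "i < 3" "j < 3" for i j
      using f(3) that by blast
    note this[of 0 1] this[of 1 0] this[of 0 2] this[of 2 0] this[of 1 2] this[of 2 1]
    ultimately have "?occ (f 0) (f 1) (f 2)" by simp
    then show "\<exists>i j k. ?occ i j k" by blast
  next
    assume "\<exists>i j k. ?occ i j k"
    then obtain i j k where occ: "?occ i j k" by blast
    define f where "f = (\<lambda>m::nat. [i, j, k] ! m)"
    have less3: "m < 3 \<longleftrightarrow> m = 0 \<or> m = 1 \<or> m = 2" for m :: nat by auto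
    have "strict_mono_on {..<3} f" "f ` {..<3} \<subseteq> {..<length p}"
      "\<forall>i<3. \<forall>j<3. p ! f i < p ! f j \<longleftrightarrow> [s, t, u] ! i < [s, t, u] ! j"
      using occ by (auto simp: strict_mono_on_def less3 f_def)
    then show "contains_pattern p [s, t, u]"
      unfolding contains_pattern_def len by blast
  qed
qed

lemma before_before_nth:
  assumes "distinct p"
  shows "before p x y \<and> before p y z \<longleftrightarrow>
    (\<exists>i j k. i < j \<and> j < k \<and> k < length p \<and> p ! i = x \<and> p ! j = y \<and> p ! k = z)"
proof
  assume "before p x y \<and> before p y z"
  then obtain i j j' k where "i < j" "j < length p" "p ! i = x" "p ! j = y"
    "j' < k" "k < length p" "p ! j' = y" "p ! k = z"
    unfolding before_iff_nth by blast
  moreover from this have "j' = j" using assms by (auto simp: nth_eq_iff_index_eq)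
  ultimately show "\<exists>i j k. i < j \<and> j < k \<and> k < length p \<and> p ! i = x \<and> p ! j = y \<and> p ! k = z"
    by blast
next
  assume "\<exists>i j k. i < j \<and> j < k \<and> k < length p \<and> p ! i = x \<and> p ! j = y \<and> p ! k = z"
  then show "before p x y \<and> before p y z"
    unfolding before_iff_nth using less_trans by blast
qed

lemma contains_132_iff:
  assumes "distinct p"
  shows "contains_pattern p [1, 3, 2] \<longleftrightarrow>
    (\<exists>a b c. before p a b \<and> before p b c \<and> a < c \<and> c < b)"
proof -
  have "contains_pattern p [1, 3, 2] \<longleftrightarrow>
    (\<exists>i j k. i < j \<and> j < k \<and> k < length p \<and> p ! i < p ! k \<and> p ! k < p ! j)"
    unfolding contains_pattern_length_3 by (intro ex_cong1) auto
  also have "\<dots> \<longleftrightarrow> (\<exists>a b c. (before p a b \<and> before p b c) \<and> a < c \<and> c < b)"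
    unfolding before_before_nth[OF assms] by blast
  finally show ?thesis by simp
qed

lemma contains_213_iff:
  assumes "distinct p"
  shows "contains_pattern p [2, 1, 3] \<longleftrightarrow>
    (\<exists>b a c. before p b a \<and> before p a c \<and> a < b \<and> b < c)"
proof -
  have "contains_pattern p [2, 1, 3] \<longleftrightarrow>
    (\<exists>i j k. i < j \<and> j < k \<and> k < length p \<and> p ! j < p ! i \<and> p ! i < p ! k)"
    unfolding contains_pattern_length_3 by (intro ex_cong1) auto
  also have "\<dots> \<longleftrightarrow> (\<exists>b a c. (before p b a \<and> before p a c) \<and> a < b \<and> b < c)"
    unfolding before_before_nth[OF assms] by blast
  finally show ?thesis by simp
qed

section \<open>Double descents\<close>

lemma has_double_descent_short: "length w < 3 \<Longrightarrow> \<not> has_double_descent w"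
  by (auto simp: has_double_descent_def)

lemma has_double_descent_Cons:
  "has_double_descent (x # w) \<longleftrightarrow>
     (\<exists>y z ws. w = y # z # ws \<and> x > y \<and> y > z) \<or> has_double_descent w"
proof
  assume "has_double_descent (x # w)"
  then obtain i where i: "i + 2 < length (x # w)" "(x # w) ! i > (x # w) ! (i + 1)"
    "(x # w) ! (i + 1) > (x # w) ! (i + 2)"
    unfolding has_double_descent_def by blast
  show "(\<exists>y z ws. w = y # z # ws \<and> x > y \<and> y > z) \<or> has_double_descent w"
  proof (cases i)
    case 0
    with i(1) obtain y z ws where "w = y # z # ws"
      by (cases w; cases "tl w") auto
    with 0 i show ?thesis by auto
  next
    case (Suc j)
    with i have "j + 2 < length w \<and> w ! j > w ! (j + 1) \<and> w ! (j + 1) > w ! (j + 2)" by auto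
    then show ?thesis unfolding has_double_descent_def by blast
  qed
next
  assume "(\<exists>y z ws. w = y # z # ws \<and> x > y \<and> y > z) \<or> has_double_descent w"
  then show "has_double_descent (x # w)"
  proof
    assume "\<exists>y z ws. w = y # z # ws \<and> x > y \<and> y > z"
    then show ?thesis unfolding has_double_descent_def by (auto intro!: exI[of _ 0])
  next
    assume "has_double_descent w"
    then obtain i where "i + 2 < length w" "w ! i > w ! (i + 1)" "w ! (i + 1) > w ! (i + 2)"
      unfolding has_double_descent_def by blast
    then show ?thesis unfolding has_double_descent_def by (intro exI[of _ "Suc i"]) auto
  qed
qed

text \<open>
  Because of the ascent from \<open>x\<close> to \<open>y\<close>, no double descent contains both. One that begins at \<open>y\<close>
  survives the deletion of \<open>y\<close>, since \<open>x\<close>, which also exceeds all entries after \<open>y\<close>, takes its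
  place; all others do not contain \<open>y\<close> and remain consecutive.
\<close>

lemma has_double_descent_delete_ascent_top:
  assumes "has_double_descent (us @ x # y # vs)" "x < y" "\<forall>v \<in> set vs. v < x"
  shows "has_double_descent (us @ x # vs)"
  using assms(1)
proof (induction us)
  case Nil
  then show ?case using assms(2,3) by (auto simp: has_double_descent_Cons)
next
  case (Cons u us)
  then consider "has_double_descent (us @ x # y # vs)"
    | b c ws where "us @ x # y # vs = b # c # ws" "u > b" "b > c"
    by (auto simp: has_double_descent_Cons)
  then show ?case
  proof cases
    case 1
    then show ?thesis using Cons.IH by (auto simp: has_double_descent_Cons)
  next
    case 2
    show ?thesis
    proof (cases us)
      case Nil
      with 2 \<open>x < y\<close> show ?thesis by auto
    next
      case us: (Cons u' us')
      with 2 show ?thesis by (cases us') (auto simp: has_double_descent_Cons)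
    qed
  qed
qed

section \<open>The largest entry of a 132- and 213-avoiding simsun permutation\<close>

definition RS_132_213 :: "nat \<Rightarrow> nat list set" where
  "RS_132_213 n = RS n [1, 3, 2] [2, 1, 3]"

text \<open>
  The restriction \<open>3 \<le> k \<le> n\<close> in the definition of simsun permutations can be dropped: a subword of
  at most two entries has no double descent, and \<open>k > n\<close> gives the whole word again. This makes
  the condition independent of \<open>n\<close> and hence evidently inherited when the largest entry is deleted.
\<close>

lemma RS_132_213_iff:
  "p \<in> RS_132_213 n \<longleftrightarrow> distinct p \<and> set p = {1..n} \<and>
     (\<forall>k. \<not> has_double_descent (filter (\<lambda>x. x \<le> k) p)) \<and>
     (\<forall>a b c. before p a b \<longrightarrow> before p b c \<longrightarrow> a < c \<longrightarrow> \<not> c < b) \<and>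
     (\<forall>a b c. before p b a \<longrightarrow> before p a c \<longrightarrow> a < b \<longrightarrow> \<not> b < c)"
proof (cases "distinct p \<and> set p = {1..n}")
  case True
  then have perm: "p \<in> permutations_of_set {1..n}" and dist: "distinct p"
    by (auto simp: permutations_of_set_def)
  have filt: "filter (\<lambda>x. x \<in> {1..k}) p = filter (\<lambda>x. x \<le> k) p" for k
    using True by (intro filter_cong) auto
  have short: "\<not> has_double_descent (filter (\<lambda>x. x \<le> k) p)" if "k < 3" for k
  proof -
    have "length (filter (\<lambda>x. x \<le> k) p) = card (set (filter (\<lambda>x. x \<le> k) p))"
      using dist by (metis distinct_card distinct_filter)
    also have "\<dots> \<le> card {1..k}" using True by (intro card_mono) auto
    finally show ?thesis using that by (intro has_double_descent_short) auto
  qed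
  have large: "filter (\<lambda>x. x \<le> k) p = filter (\<lambda>x. x \<le> n) p" if "k \<ge> n" for k
    using True that by (intro filter_cong) auto
  have "simsun n p \<longleftrightarrow> (\<forall>k. \<not> has_double_descent (filter (\<lambda>x. x \<le> k) p))"
    unfolding simsun_def filt using perm short large
    by (metis linorder_not_less nle_le)
  then show ?thesis
    using True
    unfolding RS_132_213_def RS_def mem_Collect_eq contains_132_iff[OF dist] contains_213_iff[OF dist]
    by blast
next
  case False
  then show ?thesis by (auto simp: RS_132_213_def RS_def simsun_def permutations_of_set_def)
qed

lemma RS_132_213_D:
  assumes "p \<in> RS_132_213 n"
  shows "distinct p" "set p = {1..n}"
    and "\<not> has_double_descent (filter (\<lambda>x. x \<le> k) p)"
    and "before p a b \<Longrightarrow> before p b c \<Longrightarrow> a < c \<Longrightarrow> c < b \<Longrightarrow> False"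
    and "before p b a \<Longrightarrow> before p a c \<Longrightarrow> a < b \<Longrightarrow> b < c \<Longrightarrow> False"
proof -
  note conds = assms[unfolded RS_132_213_iff]
  show "distinct p" using conds by (elim conjE)
  show "set p = {1..n}" using conds by (elim conjE)
  show "\<not> has_double_descent (filter (\<lambda>x. x \<le> k) p)" using conds by (elim conjE allE)
  have "\<forall>a b c. before p a b \<longrightarrow> before p b c \<longrightarrow> a < c \<longrightarrow> \<not> c < b" using conds by (elim conjE)
  then show "before p a b \<Longrightarrow> before p b c \<Longrightarrow> a < c \<Longrightarrow> c < b \<Longrightarrow> False" by blast
  have "\<forall>a b c. before p b a \<longrightarrow> before p a c \<longrightarrow> a < b \<longrightarrow> \<not> b < c" using conds by (elim conjE)
  then show "before p b a \<Longrightarrow> before p a c \<Longrightarrow> a < b \<Longrightarrow> b < c \<Longrightarrow> False" by blast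
qed

lemma RS_132_213_no_double_descent: "p \<in> RS_132_213 n \<Longrightarrow> \<not> has_double_descent p"
proof -
  assume p: "p \<in> RS_132_213 n"
  have "filter (\<lambda>x. x \<le> n) p = p" using RS_132_213_D(2)[OF p] by (intro filter_True) auto
  then show ?thesis using RS_132_213_D(3)[OF p, of n] by simp
qed

lemma RS_132_213_I:
  assumes "distinct p" "set p = {1..n}"
    and "\<And>k. \<not> has_double_descent (filter (\<lambda>x. x \<le> k) p)"
    and "\<And>a b c. before p a b \<Longrightarrow> before p b c \<Longrightarrow> a < c \<Longrightarrow> c < b \<Longrightarrow> False"
    and "\<And>a b c. before p b a \<Longrightarrow> before p a c \<Longrightarrow> a < b \<Longrightarrow> b < c \<Longrightarrow> False"
  shows "p \<in> RS_132_213 n"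
  unfolding RS_132_213_iff
proof (intro conjI allI impI notI)
  show "distinct p" "set p = {1..n}" by fact+
qed (use assms(3-5) in blast)+

lemma RS_132_213_remove_max:
  assumes p: "xs @ Suc n # ys \<in> RS_132_213 (Suc n)"
  shows "xs @ ys \<in> RS_132_213 n"
proof -
  let ?p = "xs @ Suc n # ys" and ?q = "xs @ ys"
  have dist: "distinct ?p" and set: "set ?p = {1..Suc n}" using RS_132_213_D(1,2)[OF p] .
  have "set ?q = set ?p - {Suc n}" using dist by auto
  also have "\<dots> = {1..Suc n} - {Suc n}" unfolding set ..
  also have "\<dots> = {1..n}" by auto
  finally have set_q: "set ?q = {1..n}" .
  have sub: "before ?p a b" if "before ?q a b" for a b
    using that by (auto simp: before_append)
  show ?thesis
  proof (rule RS_132_213_I)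
    show "distinct ?q" using dist by simp
    show "set ?q = {1..n}" by (fact set_q)
    show "\<not> has_double_descent (filter (\<lambda>x. x \<le> k) ?q)" for k
    proof -
      have "filter (\<lambda>x. x \<le> k) ?q = filter (\<lambda>x. x \<le> min k n) ?q"
        by (rule filter_cong) (simp_all only: set_q, auto)
      also have "\<dots> = filter (\<lambda>x. x \<le> min k n) ?p" by simp
      finally show ?thesis using RS_132_213_D(3)[OF p, of "min k n"] by (simp only: not_False_eq_True)
    qed
    show False if "before ?q a b" "before ?q b c" "a < c" "c < b" for a b c
      using RS_132_213_D(4)[OF p sub[OF that(1)] sub[OF that(2)] that(3,4)] .
    show False if "before ?q b a" "before ?q a c" "a < b" "b < c" for a b c
      using RS_132_213_D(5)[OF p sub[OF that(1)] sub[OF that(2)] that(3,4)] .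
  qed
qed

lemma RS_132_213_insert_max_after_previous:
  assumes p: "xs @ n # ys \<in> RS_132_213 n"
  shows "xs @ n # Suc n # ys \<in> RS_132_213 (Suc n)"
proof -
  let ?p = "xs @ n # ys" and ?q = "xs @ n # Suc n # ys"
  have dist: "distinct ?p" and set: "set ?p = {1..n}" using RS_132_213_D(1,2)[OF p] .
  have lt: "x < n" if "x \<in> set xs \<union> set ys" for x
  proof -
    have "x \<in> set ?p" "x \<noteq> n" using that dist by auto
    then show ?thesis unfolding set by simp
  qed
  have n_notin: "n \<notin> set xs" "n \<notin> set ys" "Suc n \<notin> set xs" "Suc n \<notin> set ys"
    using lt[of n] lt[of "Suc n"] by auto
  have set_q: "set ?q = insert (Suc n) (set ?p)" by auto
  have before_q: "before ?q x y \<longleftrightarrow> before ?p x y \<or>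
      (x \<in> insert n (set xs) \<and> y = Suc n) \<or> (x = Suc n \<and> y \<in> set ys)" for x y
    by (auto simp: before_append)
  have before_p_le: "x \<le> n \<and> y \<le> n" if "before ?p x y" for x y
    using before_in_set[OF that] unfolding set by simp
  show ?thesis
  proof (rule RS_132_213_I)
    show "distinct ?q" using dist n_notin by auto
    show "set ?q = {1..Suc n}" unfolding set_q set by auto
    show "\<not> has_double_descent (filter (\<lambda>x. x \<le> k) ?q)" for k
    proof (cases "k \<le> n")
      case True
      then have "filter (\<lambda>x. x \<le> k) ?q = filter (\<lambda>x. x \<le> k) ?p" by auto
      then show ?thesis using RS_132_213_D(3)[OF p, of k] by (simp only: not_False_eq_True)
    next
      case False
      then have "filter (\<lambda>x. x \<le> k) ?q = ?q"
        unfolding filter_id_conv set_q set by auto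
      moreover have "\<not> has_double_descent ?q"
        using has_double_descent_delete_ascent_top[of xs n "Suc n" ys] RS_132_213_no_double_descent[OF p] lt
        by auto
      ultimately show ?thesis by simp
    qed
    \<comment> \<open>In 132 the entry \<open>n + 1\<close> can only play the role of 3, and \<open>n\<close> just before it can replace it:
      the entry after it is smaller than \<open>n\<close>, hence so is the one playing 1.\<close>
    show False if ab: "before ?q a b" and bc: "before ?q b c" and less: "a < c" "c < b" for a b c
    proof (cases "b = Suc n")
      case True
      have "a \<in> insert n (set xs)" "c \<in> set ys"
        using ab bc True before_p_le[of a b] before_p_le[of b c] n_notin by (auto simp: before_q)
      moreover have "c < n" using lt \<open>c \<in> set ys\<close> by simp
      ultimately have "before ?p a n" "before ?p n c"
        using less by (auto simp: before_append)
      then show False using RS_132_213_D(4)[OF p] less \<open>c < n\<close> by blast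
    next
      case False
      have "b \<in> set ?q" using before_in_set[OF ab] by blast
      then have "b \<le> n" unfolding set_q set using False by auto
      then have "before ?p a b" "before ?p b c"
        using ab bc less unfolding before_q by auto
      then show False using RS_132_213_D(4)[OF p] less by blast
    qed
    \<comment> \<open>In 213, too, \<open>n + 1\<close> can only play 3 and can be replaced by \<open>n\<close>. The entry playing 1
      is less than the one playing 2, hence not \<open>n\<close>, so it stands before \<open>n\<close>; then so does the
      entry playing 2, which is therefore not \<open>n\<close> either.\<close>
    show False if ba: "before ?q b a" and ac: "before ?q a c" and less: "a < b" "b < c" for a b c
    proof -
      have "c \<in> set ?q" using before_in_set[OF ac] by blast
      then have "c \<le> Suc n" unfolding set_q set by auto
      then have ba': "before ?p b a" using ba less unfolding before_q by auto
      show False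
      proof (cases "c = Suc n")
        case False
        then have "before ?p a c" using ac less \<open>c \<le> Suc n\<close> lt unfolding before_q by auto
        then show False using RS_132_213_D(5)[OF p] ba' less by blast
      next
        case True
        then have "a \<in> set xs"
          using ac less \<open>c \<le> Suc n\<close> n_notin before_p_le[of a c] unfolding before_q by auto
        then have an: "before ?p a n" by (simp add: before_append)
        have "b \<noteq> n"
          using ba' dist \<open>a \<in> set xs\<close> before_in_set[of xs b a] before_in_set[of ys b a]
          by (auto simp: before_append)
        then have "b < n" using less True by simp
        then show False using RS_132_213_D(5)[OF p ba' an] less by blast
      qed
    qed
  qed
qed

lemma RS_132_213_entry_before_max:
  assumes p: "xs @ x # Suc n # ys \<in> RS_132_213 (Suc n)"
  shows "x = n"
proof (rule ccontr)
  let ?p = "xs @ x # Suc n # ys"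
  assume "x \<noteq> n"
  have dist: "distinct ?p" and set: "set ?p = {1..Suc n}" using RS_132_213_D(1,2)[OF p] .
  have "x \<in> set ?p" "x \<noteq> Suc n" using dist by auto
  with \<open>x \<noteq> n\<close> have "1 \<le> x" "x < n" unfolding set by auto
  then have "n \<in> set ?p" unfolding set by simp
  with \<open>x \<noteq> n\<close> have "n \<in> set xs \<or> n \<in> set ys" by auto
  then show False
  proof
    assume "n \<in> set xs"
    then have "before ?p n x" "before ?p x (Suc n)" by (auto simp: before_append)
    then show False using RS_132_213_D(5)[OF p, of n x "Suc n"] \<open>x < n\<close> by simp
  next
    assume "n \<in> set ys"
    then have "before ?p x (Suc n)" "before ?p (Suc n) n" by (auto simp: before_append)
    then show False using RS_132_213_D(4)[OF p, of x "Suc n" n] \<open>x < n\<close> by simp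
  qed
qed

text \<open>
  For \<open>n \<noteq> 1\<close> the condition \<open>hd q \<noteq> n\<close> says that \<open>q\<close> does not begin with a descent, since a
  descent at the beginning that does not involve \<open>n\<close> would be completed to 213 by \<open>n\<close>.
  For \<open>n = 1\<close> the list \<open>q = [1]\<close> is too short for a descent.
\<close>

lemma RS_132_213_Cons_max_iff:
  assumes "n \<ge> 1"
  shows "Suc n # q \<in> RS_132_213 (Suc n) \<longleftrightarrow> q \<in> RS_132_213 n \<and> (n = 1 \<or> hd q \<noteq> n)"
proof
  assume p: "Suc n # q \<in> RS_132_213 (Suc n)"
  then have q: "q \<in> RS_132_213 n" using RS_132_213_remove_max[of "[]"] by simp
  moreover have "hd q \<noteq> n" if "n \<noteq> 1"
  proof
    assume "hd q = n"
    have dist: "distinct q" and set: "set q = {1..n}" using RS_132_213_D(1,2)[OF q] .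
    then have "length q = n" using distinct_card by fastforce
    with that \<open>n \<ge> 1\<close> \<open>hd q = n\<close> obtain z r where r: "q = n # z # r"
      by (cases q; cases "tl q") auto
    have "z \<in> set q" "z \<noteq> n" using dist r by auto
    then have "z < n" unfolding set by simp
    \<comment> \<open>the word would begin with the double descent \<open>n + 1, n, z\<close>\<close>
    then show False using RS_132_213_no_double_descent[OF p] unfolding r
      by (simp add: has_double_descent_Cons)
  qed
  ultimately show "q \<in> RS_132_213 n \<and> (n = 1 \<or> hd q \<noteq> n)" by blast
next
  assume "q \<in> RS_132_213 n \<and> (n = 1 \<or> hd q \<noteq> n)"
  then have qn: "n = 1 \<or> hd q \<noteq> n" and q: "q \<in> RS_132_213 n" by auto
  have dist: "distinct q" and set: "set q = {1..n}" using RS_132_213_D(1,2)[OF q] .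
  have no_dd: "\<not> has_double_descent (Suc n # q)"
  proof
    assume dd: "has_double_descent (Suc n # q)"
    with RS_132_213_no_double_descent[OF q] obtain y z r where r: "q = y # z # r" "y > z"
      by (auto simp: has_double_descent_Cons)
    have "y \<in> set q" "z \<in> set q" using r by auto
    then have "y \<le> n" "1 \<le> z" unfolding set by auto
    then have "y \<noteq> n" using qn r by auto
    then have "y < n" "n \<noteq> z" using \<open>y \<le> n\<close> \<open>y > z\<close> by auto
    have "n \<in> set q" unfolding set using \<open>n \<ge> 1\<close> by simp
    then have "n \<in> set r" using r \<open>y \<noteq> n\<close> \<open>n \<noteq> z\<close> by auto
    \<comment> \<open>\<open>y, z, n\<close> is an occurrence of 213\<close>
    then have "before q y z" "before q z n" using r by auto
    then show False using RS_132_213_D(5)[OF q] \<open>y > z\<close> \<open>y < n\<close> by blast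
  qed
  have le: "x \<le> n" if "x \<in> set q" for x using that unfolding set by simp
  show "Suc n # q \<in> RS_132_213 (Suc n)"
  proof (rule RS_132_213_I)
    show "distinct (Suc n # q)" using dist le by fastforce
    show "set (Suc n # q) = {1..Suc n}" using set by auto
    show "\<not> has_double_descent (filter (\<lambda>x. x \<le> k) (Suc n # q))" for k
    proof (cases "k \<ge> Suc n")
      case True
      then have "filter (\<lambda>x. x \<le> k) (Suc n # q) = Suc n # q"
        unfolding filter_id_conv using le by fastforce
      then show ?thesis using no_dd by simp
    next
      case False
      then show ?thesis using RS_132_213_D(3)[OF q] by simp
    qed
    show False if "before (Suc n # q) a b" "before (Suc n # q) b c" "a < c" "c < b" for a b c
    proof -
      have "before q b c" using that before_in_set[of q a b] le[of b] by auto
      moreover have "before q a b"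
        using that le[of c] before_in_set[OF \<open>before q b c\<close>] by auto
      ultimately show False using RS_132_213_D(4)[OF q] that by blast
    qed
    show False if "before (Suc n # q) b a" "before (Suc n # q) a c" "a < b" "b < c" for a b c
    proof -
      have "c \<le> Suc n" using that(2) before_in_set[of q a c] le[of c] by auto
      then have "before q b a" "a \<noteq> Suc n" using that by auto
      then show False using RS_132_213_D(5)[OF q] that by auto
    qed
  qed
qed

section \<open>Counting\<close>

lemma finite_RS_132_213: "finite (RS_132_213 n)"
  by (rule finite_subset[of _ "permutations_of_set {1..n}"]) (auto simp: RS_132_213_def RS_def simsun_def)

lemma RS_132_213_0: "RS_132_213 0 = {[]}"
  by (auto simp: RS_132_213_iff has_double_descent_short)

lemma RS_132_213_1: "RS_132_213 1 = {[1]}"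
proof -
  have "p = [1]" if "p \<in> RS_132_213 1" for p
  proof -
    from that have "distinct p" "set p = {1}" unfolding RS_132_213_iff by auto
    then show ?thesis by (cases p; cases "tl p") auto
  qed
  moreover have "[1] \<in> RS_132_213 1" by (auto simp: RS_132_213_iff has_double_descent_short)
  ultimately show ?thesis by blast
qed

text \<open>
  The bijection is the deletion of the largest entry, written as a filter; its inverse inserts
  \<open>n + 1\<close> directly after \<open>n\<close>. The assumption \<open>n \<ge> 1\<close> provides the entry \<open>n\<close> to insert after.
\<close>

lemma card_RS_132_213_max_not_first:
  assumes "n \<ge> 1"
  shows "card {p \<in> RS_132_213 (Suc n). hd p \<noteq> Suc n} = card (RS_132_213 n)"
proof (rule bij_betw_same_card)
  let ?A = "{p \<in> RS_132_213 (Suc n). hd p \<noteq> Suc n}"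
  have A: "\<exists>us vs. p = us @ n # Suc n # vs \<and> us @ n # vs \<in> RS_132_213 n \<and>
      filter (\<lambda>x. x \<le> n) p = us @ n # vs" if "p \<in> ?A" for p
  proof -
    have "set p = {1..Suc n}" using that unfolding RS_132_213_iff by blast
    then have "Suc n \<in> set p" by simp
    then obtain xs ys where p: "p = xs @ Suc n # ys" by (auto simp: in_set_conv_decomp)
    have "xs \<noteq> []" using that p by auto
    then obtain us x where xs: "xs = us @ [x]" by (cases xs rule: rev_cases) auto
    have "x = n" using RS_132_213_entry_before_max[of us x n ys] that p xs by auto
    moreover have xy: "xs @ ys \<in> RS_132_213 n" using RS_132_213_remove_max[of xs n ys] that p by auto
    moreover have "set (xs @ ys) = {1..n}" using xy unfolding RS_132_213_iff by blast
    then have "filter (\<lambda>x. x \<le> n) (xs @ ys) = xs @ ys" by (intro filter_True) auto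
    then have "filter (\<lambda>x. x \<le> n) p = xs @ ys" using p by simp
    ultimately show ?thesis using p xs by auto
  qed
  show "bij_betw (filter (\<lambda>x. x \<le> n)) ?A (RS_132_213 n)"
    unfolding bij_betw_def
  proof
    show "inj_on (filter (\<lambda>x. x \<le> n)) ?A"
    proof (rule inj_onI)
      fix p q assume "p \<in> ?A" "q \<in> ?A" and eq: "filter (\<lambda>x. x \<le> n) p = filter (\<lambda>x. x \<le> n) q"
      obtain us vs where p: "p = us @ n # Suc n # vs" "us @ n # vs \<in> RS_132_213 n"
        "filter (\<lambda>x. x \<le> n) p = us @ n # vs" using A[OF \<open>p \<in> ?A\<close>] by blast
      obtain us' vs' where q: "q = us' @ n # Suc n # vs'"
        "filter (\<lambda>x. x \<le> n) q = us' @ n # vs'" using A[OF \<open>q \<in> ?A\<close>] by blast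
      have "distinct (us @ n # vs)" using p(2) unfolding RS_132_213_iff by blast
      moreover have "us @ n # vs = us' @ n # vs'" using eq p q by simp
      ultimately have "us = us' \<and> vs = vs'"
        by (subst (asm) append_Cons_eq_iff) auto
      then show "p = q" using p q by simp
    qed
    show "filter (\<lambda>x. x \<le> n) ` ?A = RS_132_213 n"
    proof (intro equalityI subsetI)
      fix p assume "p \<in> filter (\<lambda>x. x \<le> n) ` ?A"
      then show "p \<in> RS_132_213 n" using A by force
    next
      fix q assume q: "q \<in> RS_132_213 n"
      then have set: "set q = {1..n}" unfolding RS_132_213_iff by blast
      then have "n \<in> set q" using assms by simp
      then obtain us vs where q_split: "q = us @ n # vs" by (auto simp: in_set_conv_decomp)
      let ?p = "us @ n # Suc n # vs"
      have "?p \<in> RS_132_213 (Suc n)" using q q_split RS_132_213_insert_max_after_previous by simp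
      moreover have "hd ?p \<in> set q" unfolding q_split by (cases us) auto
      then have "hd ?p \<noteq> Suc n" using set by auto
      moreover have "filter (\<lambda>x. x \<le> n) q = q" using set by (intro filter_True) auto
      then have "filter (\<lambda>x. x \<le> n) ?p = q" unfolding q_split by simp
      ultimately show "q \<in> filter (\<lambda>x. x \<le> n) ` ?A"
        by (intro image_eqI[of _ _ ?p]) auto
    qed
  qed
qed

lemma card_RS_132_213_max_first:
  assumes "n \<ge> 1"
  shows "card {p \<in> RS_132_213 (Suc n). hd p = Suc n} = card (RS_132_213 (n - 1))"
proof -
  have split: "p = Suc n # tl p" if "p \<in> RS_132_213 (Suc n)" "hd p = Suc n" for p
    using that RS_132_213_D(2)[OF that(1)] by (cases p) auto
  have "{p \<in> RS_132_213 (Suc n). hd p = Suc n} = (#) (Suc n) ` {q. Suc n # q \<in> RS_132_213 (Suc n)}"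
  proof (intro equalityI subsetI)
    fix p assume "p \<in> {p \<in> RS_132_213 (Suc n). hd p = Suc n}"
    then have "p \<in> RS_132_213 (Suc n)" "p = Suc n # tl p" using split by blast+
    then show "p \<in> (#) (Suc n) ` {q. Suc n # q \<in> RS_132_213 (Suc n)}"
      by (metis imageI mem_Collect_eq)
  qed auto
  also have "{q. Suc n # q \<in> RS_132_213 (Suc n)} = {q \<in> RS_132_213 n. n = 1 \<or> hd q \<noteq> n}"
    using RS_132_213_Cons_max_iff[OF assms] by blast
  finally have "{p \<in> RS_132_213 (Suc n). hd p = Suc n} = (#) (Suc n) ` {q \<in> RS_132_213 n. n = 1 \<or> hd q \<noteq> n}" .
  then have "card {p \<in> RS_132_213 (Suc n). hd p = Suc n} = card {q \<in> RS_132_213 n. n = 1 \<or> hd q \<noteq> n}"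
    by (simp add: card_image)
  also have "\<dots> = card (RS_132_213 (n - 1))"
  proof (cases "n = 1")
    case True
    then show ?thesis using RS_132_213_0 RS_132_213_1 by simp
  next
    case False
    with assms obtain m where "n = Suc m" "m \<ge> 1" by (cases n) auto
    then show ?thesis using card_RS_132_213_max_not_first[of m] by simp
  qed
  finally show ?thesis .
qed

lemma card_RS_132_213_recurrence: "card (RS_132_213 (n + 2)) = card (RS_132_213 (n + 1)) + card (RS_132_213 n)"
proof -
  let ?A = "{p \<in> RS_132_213 (Suc (n + 1)). hd p \<noteq> Suc (n + 1)}"
  let ?B = "{p \<in> RS_132_213 (Suc (n + 1)). hd p = Suc (n + 1)}"
  have "RS_132_213 (n + 2) = ?A \<union> ?B" by auto
  moreover have "card (?A \<union> ?B) = card ?A + card ?B"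
    using finite_RS_132_213[of "Suc (n + 1)"] by (intro card_Un_disjoint) auto
  moreover have "card ?A = card (RS_132_213 (n + 1))" by (rule card_RS_132_213_max_not_first) simp
  moreover have "card ?B = card (RS_132_213 n)" using card_RS_132_213_max_first[of "n + 1"] by simp
  ultimately show ?thesis by simp
qed

theorem lemma7p4:
  fixes n :: nat
  shows "card (RS n [1, 3, 2] [2, 1, 3]) = fib (n + 1)"
  unfolding RS_132_213_def[symmetric]
proof (induction n rule: fib.induct)
  case 1
  show ?case by (simp add: RS_132_213_0)
next
  case 2
  show ?case using RS_132_213_1 by simp
next
  case (3 n)
  then show ?case using card_RS_132_213_recurrence[of n] by simp
qed

end
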